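(* Let $q$ be a prime power, $\mathcal A=\mathbb F_q^N$, $\mathsf M=q^m$ with $m\le N$, $\mathcal E$ a finite set, $P_{A,E}$ a probability distribution on $\mathcal A\times\mathcal E$, and let $f_{\mathbf X}$ be a linear random hash function from $\mathcal A$ to $\mathbb F_q^m\cong\{1,\dots,\mathsf M\}$ that is $\varepsilon$-almost dual universal$_2$. Then $$\mathrm E_{\mathbf X}\,I'(f_{\mathbf X}(A)|E|P_{A,E})\le\underline\Delta_{I,\min}(\mathsf M,\varepsilon|P_{A,E}),$$ where $$\underline\Delta_{I,\min}(\mathsf M,\varepsilon|P_{A,E}):=\min_{P'_{A,E}:\,P'_E\le P_E}\Bigl[\eta(\|P_{A,E}-P'_{A,E}\|_1,\log\mathsf M)+\log\bigl(1+\varepsilon\mathsf M e^{-H_{\min}(A|E|P'_{A,E}\|P_E)}\bigr)\Bigr]$$ $$=\min_{\epsilon_1>0}\Bigl[\eta(\epsilon_1,\log\mathsf M)+\log\bigl(1+\varepsilon\mathsf M e^{-H_{\min}^{\downarrow,\epsilon_1}(A|E|P_{A,E})}\bigr)\Bigr]$$ $$=\min_{R'}\Bigl[\eta\Bigl(\min_{P'_{A,E}:\,P'_E\le P_E,\ H_{\min}(A|E|P'_{A,E}\|P_E)\ge R'}\|P_{A,E}-P'_{A,E}\|_1,\ \log\mathsf M\Bigr)+\log\bigl(1+\varepsilon\mathsf M e^{-R'}\bigr)\Bigr].$$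
   Context: Logarithms are natural. A sub-distribution is a nonnegative function with total sum $\le1$; $P_E(e)=\sum_aP_{A,E}(a,e)$, $P'_E(e)=\sum_aP'_{A,E}(a,e)$; $\|\cdot\|_1$ is the sum of absolute values; $\eta(x,y)=xy-x\log x$. $P'_{A,E}$ ranges over sub-distributions on $\mathcal A\times\mathcal E$, $R'$ over $\mathbb R$, and outer minima are understood as infima. $H_{\min}(A|E|P'\|P_E)=-\log\max_{(a,e):P_E(e)>0}\frac{P'(a,e)}{P_E(e)}$, and $H_{\min}^{\downarrow,\epsilon_1}(A|E|P_{A,E})=\max\{H_{\min}(A|E|P'_{A,E}\|P_E):\|P_{A,E}-P'_{A,E}\|_1\le\epsilon_1,\ P'_E\le P_E\}$. Hash functions: $\mathbf X$ is a random variable (independent of $(A,E)$); for each value $x$, $f_x:\mathbb F_q^N\to\mathbb F_q^m$ is an $\mathbb F_q$-linear map with kernel $C_x$ (of dimension $N-m$ or more), and $C_x^\perp=\{y\in\mathbb F_q^N:\sum_iy_iz_i=0\ \forall z\in C_x\}$ is the dual code. $f_{\mathbf X}$ is $\varepsilon$-almost dual universal$_2$ if the kernels have minimum dimension $\min_x\dim C_x=N-m$ (equivalently, the dual codes have maximum dimension $m$) and $\Pr[y\in C_{\mathbf X}^\perp]\le\varepsilon q^{m-N}$ for all $y\in\mathbb F_q^N\setminus\{0\}$. For a map $f$ from $\mathcal A$ to an $\mathsf M$-element set, $P_{f(A),E}(b,e)=\sum_{a:f(a)=b}P_{A,E}(a,e)$ and $I'(f(A)|E|P_{A,E})=\sum_{b,e}P_{f(A),E}(b,e)\log\frac{\mathsf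 M P_{f(A),E}(b,e)}{P_E(e)}$.
   Formalization: As written this is false. Mended: ε₁, and for M<4 also ‖P−P'‖₁ in the first minimum, must be ≤1 or satisfy η(·,log M)≥log M; the bound is stated when all f_x are surjective, otherwise with the added term E log(M/|f_X(A)|). The third minimum is literal. *)

theory Defs
  imports "HOL-Probability.Probability"
begin

section \<open>Distributions and smoothed min-entropy\<close>

definition prob_dist :: "('a::finite \<Rightarrow> 'e::finite \<Rightarrow> real) \<Rightarrow> bool" where
  "prob_dist P \<longleftrightarrow> (\<forall>a e. 0 \<le> P a e) \<and> (\<Sum>a\<in>UNIV. \<Sum>e\<in>UNIV. P a e) = 1"

definition sub_dist :: "('a::finite \<Rightarrow> 'e::finite \<Rightarrow> real) \<Rightarrow> bool" where
  "sub_dist P \<longleftrightarrow> (\<forall>a e. 0 \<le> P a e) \<and> (\<Sum>a\<in>UNIV. \<Sum>e\<in>UNIV. P a e) \<le> 1"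

definition marg :: "('a::finite \<Rightarrow> 'e \<Rightarrow> real) \<Rightarrow> 'e \<Rightarrow> real" where
  "marg P e = (\<Sum>a\<in>UNIV. P a e)"

definition l1_dist :: "('a::finite \<Rightarrow> 'e::finite \<Rightarrow> real) \<Rightarrow> ('a \<Rightarrow> 'e \<Rightarrow> real) \<Rightarrow> real" where
  "l1_dist P P' = (\<Sum>a\<in>UNIV. \<Sum>e\<in>UNIV. \<bar>P a e - P' a e\<bar>)"

definition dominated_subs :: "('a::finite \<Rightarrow> 'e::finite \<Rightarrow> real) \<Rightarrow> ('a \<Rightarrow> 'e \<Rightarrow> real) set" where
  "dominated_subs P = {P'. sub_dist P' \<and> (\<forall>e. marg P' e \<le> marg P e)}"

text \<open>Since \<open>- log 0 = \<infinity>\<close> (attained by \<open>P' = 0\<close>), min-entropies are extended reals.\<close>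

definition Hmin :: "('a::finite \<Rightarrow> 'e::finite \<Rightarrow> real) \<Rightarrow> ('e \<Rightarrow> real) \<Rightarrow> ereal" where
  "Hmin P' Q = (let r = Max ((\<lambda>(a, e). P' a e / Q e) ` {(a, e). 0 < Q e})
                in if r = 0 then \<infinity> else ereal (- ln r))"

definition Hmin_down :: "real \<Rightarrow> ('a::finite \<Rightarrow> 'e::finite \<Rightarrow> real) \<Rightarrow> ereal" where
  "Hmin_down \<epsilon>1 P = (SUP P'\<in>{P' \<in> dominated_subs P. l1_dist P P' \<le> \<epsilon>1}. Hmin P' (marg P))"

text \<open>\<open>exp_neg h = e\<^sup>-\<^sup>h\<close>. The value \<open>- \<infinity>\<close> never occurs below, because
  \<open>P'\<^sub>E \<le> P\<^sub>E\<close> forces \<open>Hmin P' (marg P) \<ge> 0\<close>.\<close>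

definition exp_neg :: "ereal \<Rightarrow> real" where
  "exp_neg h = (if h = \<infinity> then 0 else exp (- real_of_ereal h))"

definition eta :: "real \<Rightarrow> real \<Rightarrow> real" where
  "eta x y = x * y - x * ln x"


section \<open>Linear hash functions\<close>

definition ker_code :: "(('k::{field,finite})^'n \<Rightarrow> 'k^'m) \<Rightarrow> ('k^'n) set" where
  "ker_code f = {v. f v = 0}"

definition dual_code :: "(('k::{field,finite})^'n) set \<Rightarrow> ('k^'n) set" where
  "dual_code C = {y. \<forall>z\<in>C. (\<Sum>i\<in>UNIV. y $ i * z $ i) = 0}"

definition linear_hash :: "'x pmf \<Rightarrow> ('x \<Rightarrow> ('k::{field,finite})^'n \<Rightarrow> 'k^'m) \<Rightarrow> bool" where
  "linear_hash X f \<longleftrightarrow> (\<forall>x\<in>set_pmf X. Vector_Spaces.linear (*s) (*s) (f x))"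

definition almost_dual_universal2 ::
    "real \<Rightarrow> 'x pmf \<Rightarrow> ('x \<Rightarrow> ('k::{field,finite})^'n \<Rightarrow> 'k^'m) \<Rightarrow> bool" where
  "almost_dual_universal2 \<epsilon> X f \<longleftrightarrow>
     Min ((\<lambda>x. vec.dim (ker_code (f x))) ` set_pmf X) = CARD('n) - CARD('m) \<and>
     (\<forall>y. y \<noteq> 0 \<longrightarrow>
        measure_pmf.prob X {x. y \<in> dual_code (ker_code (f x))}
          \<le> \<epsilon> * real CARD('k) powi (int CARD('m) - int CARD('n)))"

definition hashed :: "('a::finite \<Rightarrow> 'b) \<Rightarrow> ('a \<Rightarrow> 'e \<Rightarrow> real) \<Rightarrow> 'b \<Rightarrow> 'e \<Rightarrow> real" where
  "hashed f P b e = (\<Sum>a\<in>{a. f a = b}. P a e)"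

definition I' :: "('a::finite \<Rightarrow> 'b::finite) \<Rightarrow> ('a \<Rightarrow> 'e::finite \<Rightarrow> real) \<Rightarrow> real" where
  "I' f P = (\<Sum>b\<in>UNIV. \<Sum>e\<in>UNIV.
     hashed f P b e * ln (real CARD('b) * hashed f P b e / marg P e))"


section \<open>The bound\<close>

text \<open>
  The function \<open>x \<mapsto> eta x (ln M)\<close> is concave, equals \<open>ln M\<close> at \<open>x = 1\<close> and tends to \<open>- \<infinity>\<close>, so
  for \<open>x > 1\<close> it eventually drops below \<open>ln M\<close>, the largest possible value of \<open>I'\<close>.
  A smoothing radius in that range does not give a valid bound, and the infimum over all
  \<open>\<epsilon>1 > 0\<close> would be \<open>- \<infinity>\<close>. Exactly these radii are excluded. By \<open>smoothing_radius_le_2\<close>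
  and \<open>l1_dist_le_2\<close> no sub-distribution is excluded when \<open>M \<ge> 4\<close>.
\<close>

definition smoothing_radius :: "real \<Rightarrow> real set" where
  "smoothing_radius M = {x. x \<le> 1 \<or> ln M \<le> eta x (ln M)}"

definition Delta_min :: "real \<Rightarrow> real \<Rightarrow> ('a::finite \<Rightarrow> 'e::finite \<Rightarrow> real) \<Rightarrow> ereal" where
  "Delta_min M \<epsilon> P =
     (INF P'\<in>{P' \<in> dominated_subs P. l1_dist P P' \<in> smoothing_radius M}.
        ereal (eta (l1_dist P P') (ln M) + ln (1 + \<epsilon> * M * exp_neg (Hmin P' (marg P)))))"

definition Delta_min_smooth :: "real \<Rightarrow> real \<Rightarrow> ('a::finite \<Rightarrow> 'e::finite \<Rightarrow> real) \<Rightarrow> ereal" where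
  "Delta_min_smooth M \<epsilon> P =
     (INF \<epsilon>1\<in>{\<epsilon>1. 0 < \<epsilon>1 \<and> \<epsilon>1 \<in> smoothing_radius M}.
        ereal (eta \<epsilon>1 (ln M) + ln (1 + \<epsilon> * M * exp_neg (Hmin_down \<epsilon>1 P))))"

definition Delta_min_rate :: "real \<Rightarrow> real \<Rightarrow> ('a::finite \<Rightarrow> 'e::finite \<Rightarrow> real) \<Rightarrow> ereal" where
  "Delta_min_rate M \<epsilon> P =
     (INF R'. ereal (eta (INF P'\<in>{P' \<in> dominated_subs P. ereal R' \<le> Hmin P' (marg P)}. l1_dist P P')
                         (ln M)
                     + ln (1 + \<epsilon> * M * exp (- R'))))"

lemma smoothing_radius_le_2:
  assumes "4 \<le> M" "x \<le> 2"
  shows "x \<in> smoothing_radius M"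
proof (cases "x \<le> 1")
  case False
  have conv: "convex_on {1..2::real} (\<lambda>x. x * ln x)"
    by (rule convex_on_realI[where f' = "\<lambda>x. ln x + 1"])
       (auto intro!: derivative_eq_intros)
  have "(\<lambda>x. x * ln x) ((1 - (x - 1)) *\<^sub>R 1 + (x - 1) *\<^sub>R 2)
      \<le> (1 - (x - 1)) * (1 * ln 1) + (x - 1) * (2 * ln (2::real))"
    using convex_onD[OF conv, of "x - 1" 1 2] assms False by auto
  then have 1: "x * ln x \<le> (x - 1) * (2 * ln 2)" by (simp add: algebra_simps)
  have "2 * ln 2 = ln ((2::real) ^ 2)" by (subst ln_realpow) auto
  also have "\<dots> \<le> ln M" using assms by simp
  finally have "(x - 1) * (2 * ln 2) \<le> (x - 1) * ln M"
    using False by (intro mult_left_mono) auto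
  with 1 show ?thesis by (simp add: smoothing_radius_def eta_def algebra_simps)
qed (simp add: smoothing_radius_def)

lemma l1_dist_le_2:
  assumes "prob_dist P" "P' \<in> dominated_subs P"
  shows "l1_dist P P' \<le> 2"
proof -
  have "l1_dist P P' \<le> (\<Sum>a\<in>UNIV. \<Sum>e\<in>UNIV. P a e + P' a e)"
    unfolding l1_dist_def using assms
    by (intro sum_mono) (auto simp: prob_dist_def dominated_subs_def sub_dist_def abs_le_iff)
  also have "\<dots> \<le> 2"
    using assms by (simp add: sum.distrib prob_dist_def dominated_subs_def sub_dist_def)
  finally show ?thesis .
qed

end

theory Submission
  imports Defs "HOL-Real_Asymp.Real_Asymp"
begin

text \<open>
  For a linear hash \<open>h\<close> with range of size \<open>L\<close>, the collision mass
  \<open>L * \<Sum>b. P'(h = b)\<^sup>2\<close> is the energy of the Fourier transform of \<open>P'\<close> on the dual code of the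
  kernel. The universality condition bounds the probability that a frequency \<open>y \<noteq> 0\<close> lies in
  this code, so by Parseval the expected collision mass is at most
  \<open>(\<Sum>a. P' a)\<^sup>2 + \<epsilon> * M * \<Sum>a. (P' a)\<^sup>2\<close>.

  Given a smoothing \<open>P'\<close>, replace it by \<open>min P P'\<close>, and for each \<open>e\<close> write \<open>P\<close> as the sum of
  this minorant and a remainder. By the log sum inequality the remainder, of total mass
  \<open>d \<le> l1_dist P P'\<close>, contributes at most \<open>d * ln M\<close>, which the \<open>eta\<close> term absorbs. The
  minorant contributes at most \<open>ln (1 + \<epsilon> * M * g)\<close> with \<open>g\<close> the largest ratio
  \<open>P'(a, e) / P\<^sub>E(e)\<close>, by the tangent of \<open>ln\<close> at the expected collision mass.

  The three forms of the bound agree because \<open>x \<mapsto> eta x (ln M)\<close> is concave with value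
  \<open>ln M\<close> at \<open>1\<close>: wherever it is below \<open>ln M\<close> on \<open>[0, 1]\<close> it is monotone up to that point, and
  wherever it is at least \<open>ln M\<close> the choice \<open>P' = 0\<close> is at least as good.
\<close>

section \<open>Collision probabilities of linear maps over a finite field\<close>

definition dot :: "('k::{field,finite})^'n \<Rightarrow> 'k^'n \<Rightarrow> 'k" where
  "dot y z = (\<Sum>i\<in>UNIV. y $ i * z $ i)"

lemma dot_commute: "dot y z = dot z y"
  by (simp add: dot_def mult.commute)

lemma dot_add_left: "dot (y + y') z = dot y z + dot y' z"
  by (simp add: dot_def ring_distribs sum.distrib)

lemma dot_diff_right: "dot y (z - z') = dot y z - dot y z'"
  by (simp add: dot_def ring_distribs sum_subtractf)

lemma dot_scale_left: "dot (c *s y) z = c * dot y z"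
  by (simp add: dot_def sum_distrib_left mult.assoc)

lemma dot_zero_left [simp]: "dot 0 z = 0"
  by (simp add: dot_def)

lemma dot_axis: "dot y (axis i 1) = y $ i"
  by (simp add: dot_def axis_def if_distrib cong: if_cong)

lemma mem_dual_code: "y \<in> dual_code C \<longleftrightarrow> (\<forall>z\<in>C. dot y z = 0)"
  by (simp add: dual_code_def dot_def)

text \<open>Translation by a multiple of \<open>y0\<close> carries the zero fibre of
  \<open>dot _ z\<close> on \<open>D\<close> onto any other fibre, so \<open>D\<close> splits into
  \<open>CARD('k)\<close> classes of equal size.\<close>

lemma card_orthogonal:
  fixes D :: "(('k::{field,finite})^'n) set"
  assumes add: "\<And>u v. u \<in> D \<Longrightarrow> v \<in> D \<Longrightarrow> u + v \<in> D"
    and scale: "\<And>c u. u \<in> D \<Longrightarrow> c *s u \<in> D"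
    and y0: "y0 \<in> D" "dot y0 z \<noteq> 0"
  shows "CARD('k) * card {y\<in>D. dot y z = 0} = card D"
proof -
  have "card {y\<in>D. dot y z = t} = card {y\<in>D. dot y z = 0}" for t
  proof -
    define u where "u = (t / dot y0 z) *s y0"
    have u: "u \<in> D" "dot u z = t" using y0 by (auto simp: u_def scale dot_scale_left)
    have mu: "- u \<in> D" using scale[of u "- 1"] u by simp
    have "bij_betw (\<lambda>y. y + u) {y\<in>D. dot y z = 0} {y\<in>D. dot y z = t}"
    proof (rule bij_betw_byWitness[where f' = "\<lambda>y. y + (- u)"])
      have "dot (- u) z = - t" using u by (simp add: dot_def sum_negf)
      then show "(\<lambda>y. y + (- u)) ` {y\<in>D. dot y z = t} \<subseteq> {y\<in>D. dot y z = 0}"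
        using add[OF _ mu] by (auto simp: dot_add_left simp del: add_uminus_conv_diff)
    qed (use u add in \<open>auto simp: dot_add_left\<close>)
    then show ?thesis by (simp add: bij_betw_same_card)
  qed
  then have "(\<Sum>t\<in>UNIV. card {y\<in>D. dot y z = t}) = (\<Sum>t\<in>(UNIV::'k set). card {y\<in>D. dot y z = 0})"
    by (intro sum.cong refl)
  moreover have "card D = (\<Sum>t\<in>UNIV. card {y\<in>D. dot y z = t})"
    using sum.group[of D "UNIV :: 'k set" "\<lambda>y. dot y z" "\<lambda>_. 1 :: nat"] by simp
  ultimately show ?thesis by simp
qed

lemma card_field_ge_2: "2 \<le> CARD('k::{field,finite})"
proof -
  have "card {0, 1 :: 'k} \<le> CARD('k)" by (intro card_mono) auto
  then show ?thesis by simp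
qed

text \<open>The sum of \<open>\<chi> (c * t)\<close> over all \<open>c \<noteq> 0\<close> for a nontrivial additive character \<open>\<chi>\<close>.\<close>

definition ramanujan :: "'k::{field,finite} \<Rightarrow> real" where
  "ramanujan t = (if t = 0 then real CARD('k) else 0) - 1"

lemma sum_ramanujan:
  fixes D :: "(('k::{field,finite})^'n) set"
  shows "(\<Sum>y\<in>D. ramanujan (dot y z)) = real CARD('k) * card {y\<in>D. dot y z = 0} - card D"
proof -
  have "(\<Sum>y\<in>D. if dot y z = 0 then real CARD('k) else 0) = real CARD('k) * card {y\<in>D. dot y z = 0}"
    by (simp add: sum.If_cases Int_def)
  then show ?thesis by (simp add: ramanujan_def sum_subtractf)
qed

text \<open>Orthogonality of characters: a nonzero functional takes every value equally often on
  \<open>D\<close>, so the terms cancel.\<close>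

lemma sum_ramanujan_eq_0:
  fixes D :: "(('k::{field,finite})^'n) set"
  assumes "\<And>u v. u \<in> D \<Longrightarrow> v \<in> D \<Longrightarrow> u + v \<in> D" "\<And>c u. u \<in> D \<Longrightarrow> c *s u \<in> D"
    and "y0 \<in> D" "dot y0 z \<noteq> 0"
  shows "(\<Sum>y\<in>D. ramanujan (dot y z)) = 0"
proof -
  have "real (CARD('k) * card {y\<in>D. dot y z = 0}) = real (card D)"
    using card_orthogonal[OF assms] by simp
  then show ?thesis by (simp add: sum_ramanujan)
qed

lemma dual_code_closed:
  "u \<in> dual_code C \<Longrightarrow> v \<in> dual_code C \<Longrightarrow> u + v \<in> dual_code C"
  "u \<in> dual_code C \<Longrightarrow> c *s u \<in> dual_code C"
  by (auto simp: mem_dual_code dot_add_left dot_scale_left)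

text \<open>The rows of the matrix of \<open>f\<close> vanish on the kernel and so lie in the dual
  code; a row at a nonzero coordinate of \<open>f z\<close> detects \<open>z\<close>.\<close>

lemma separating_dual_vector:
  fixes f :: "('k::{field,finite})^'n \<Rightarrow> 'k^'m"
  assumes "Vector_Spaces.linear (*s) (*s) f" "f z \<noteq> 0"
  obtains y where "y \<in> dual_code (ker_code f)" "dot y z \<noteq> 0"
proof -
  have row: "dot (matrix f $ i) v = f v $ i" for i v
    using arg_cong[OF matrix_works[OF assms(1), of v], of "\<lambda>w. w $ i"]
    by (simp add: matrix_vector_mult_def dot_def)
  obtain i where "f z $ i \<noteq> 0" using assms(2) by (auto simp: vec_eq_iff)
  then show ?thesis
    by (intro that[of "matrix f $ i"]) (auto simp: mem_dual_code ker_code_def row)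
qed

text \<open>Rank-nullity in counting form: every nonempty fibre is a coset of the kernel.\<close>

lemma card_ker_times_range:
  fixes f :: "('k::{field,finite})^'n \<Rightarrow> 'k^'m"
  assumes lin: "Vector_Spaces.linear (*s) (*s) f"
  shows "card (ker_code f) * card (range f) = CARD('k^'n)"
proof -
  interpret f: Vector_Spaces.linear "(*s)" "(*s)" f by (rule lin)
  have "card {a. f a = b} = card (ker_code f)" if "b \<in> range f" for b
  proof -
    from that obtain u where u: "b = f u" by auto
    have "bij_betw (\<lambda>y. y + u) (ker_code f) {a. f a = b}"
      by (rule bij_betw_byWitness[where f' = "\<lambda>y. y - u"])
         (auto simp: ker_code_def u f.add f.diff)
    then show ?thesis by (simp add: bij_betw_same_card)
  qed
  then have "(\<Sum>b\<in>range f. card {a. f a = b}) = card (ker_code f) * card (range f)" by simp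
  moreover have "CARD('k^'n) = (\<Sum>b\<in>range f. card {a. f a = b})"
    using sum.group[of "UNIV :: ('k^'n) set" "range f" f "\<lambda>_. 1 :: nat"] by simp
  ultimately show ?thesis by simp
qed

text \<open>If \<open>f z = 0\<close>, every dual vector is orthogonal to \<open>z\<close>;
  otherwise a separating dual vector makes the sum cancel. This gives the formula with
  \<open>card D\<close>, which is then identified with \<open>card (range f)\<close>.\<close>

lemma sum_ramanujan_dual:
  fixes f :: "('k::{field,finite})^'n \<Rightarrow> 'k^'m"
  assumes lin: "Vector_Spaces.linear (*s) (*s) f"
  defines "D \<equiv> dual_code (ker_code f)"
  shows "(\<Sum>y\<in>D. ramanujan (dot y z)) = (if f z = 0 then (real CARD('k) - 1) * card (range f) else 0)"
proof -
  let ?q = "real CARD('k)"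
  have q: "?q > 1" using card_field_ge_2[where 'k = 'k] by linarith
  have 1: "(\<Sum>y\<in>D. ramanujan (dot y z)) = (if f z = 0 then (?q - 1) * card D else 0)" for z
  proof (cases "f z = 0")
    case True
    then have "\<And>y. y \<in> D \<Longrightarrow> dot y z = 0" by (auto simp: D_def mem_dual_code ker_code_def)
    then show ?thesis using True by (simp add: ramanujan_def)
  next
    case False
    obtain y0 where "y0 \<in> D" "dot y0 z \<noteq> 0"
      using separating_dual_vector[OF lin False] unfolding D_def by blast
    then show ?thesis using False sum_ramanujan_eq_0[of D y0 z]
      by (simp add: D_def dual_code_closed)
  qed
  have 2: "(\<Sum>z\<in>UNIV. ramanujan (dot y z)) = (if y = 0 then (?q - 1) * CARD('k^'n) else 0)"
    for y :: "'k^'n"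
  proof (cases "y = 0")
    case False
    then obtain i where "y $ i \<noteq> 0" by (auto simp: vec_eq_iff)
    then have "dot (axis i 1) y \<noteq> 0" by (subst dot_commute) (simp add: dot_axis)
    then show ?thesis using False sum_ramanujan_eq_0[of UNIV "axis i 1" y]
      by (simp add: dot_commute[of y])
  qed (simp add: ramanujan_def)
  \<comment> \<open>Double counting over all pairs \<open>(z, y)\<close> gives
    \<open>card D * card (ker_code f) = CARD('k^'n)\<close>, which determines the size of the dual
    code.\<close>
  have "(?q - 1) * card D * card (ker_code f) = (\<Sum>z\<in>UNIV. \<Sum>y\<in>D. ramanujan (dot y z))"
    by (simp add: 1 sum.If_cases ker_code_def)
  also have "\<dots> = (\<Sum>y\<in>D. \<Sum>z\<in>UNIV. ramanujan (dot y z))" by (rule sum.swap)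
  also have "\<dots> = (?q - 1) * CARD('k^'n)"
  proof -
    have "0 \<in> D" by (simp add: D_def mem_dual_code)
    then show ?thesis by (simp only: 2) simp
  qed
  finally have "real (card D) * card (ker_code f) = CARD('k^'n)" using q by simp
  then have "card D * card (ker_code f) = card (range f) * card (ker_code f)"
    using card_ker_times_range[OF lin] by (simp flip: of_nat_mult add: mult.commute)
  moreover have "card (ker_code f) > 0"
    using card_ker_times_range[OF lin] by (cases "card (ker_code f)") auto
  ultimately have "card D = card (range f)" by (metis mult_cancel2 not_gr_zero)
  then show ?thesis by (simp add: 1)
qed

section \<open>Fourier weights and the collision identity\<close>

lemma sum_fibre_squared:
  fixes p :: "'a::finite \<Rightarrow> real" and \<phi> :: "'a \<Rightarrow> 'b::finite"
  shows "(\<Sum>t\<in>UNIV. (\<Sum>a | \<phi> a = t. p a)\<^sup>2)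
    = (\<Sum>a\<in>UNIV. \<Sum>a'\<in>UNIV. p a * p a' * (if \<phi> a = \<phi> a' then 1 else 0))"
proof -
  have fibre: "(\<Sum>a' | \<phi> a' = \<phi> a. p a') = (\<Sum>a'\<in>UNIV. p a' * (if \<phi> a = \<phi> a' then 1 else 0))" for a
    by (rule sum.mono_neutral_cong_left) auto
  have "(\<Sum>a | \<phi> a = t. p a)\<^sup>2 = (\<Sum>a | \<phi> a = t. p a * (\<Sum>a' | \<phi> a' = \<phi> a. p a'))" for t
    unfolding power2_eq_square sum_distrib_right by (rule sum.cong) auto
  then have "(\<Sum>t\<in>UNIV. (\<Sum>a | \<phi> a = t. p a)\<^sup>2) = (\<Sum>a\<in>UNIV. p a * (\<Sum>a' | \<phi> a' = \<phi> a. p a'))"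
    using sum.group[of "UNIV :: 'a set" "UNIV :: 'b set" \<phi>
        "\<lambda>a. p a * (\<Sum>a' | \<phi> a' = \<phi> a. p a')"] by simp
  then show ?thesis by (simp add: fibre sum_distrib_left mult.assoc)
qed

text \<open>The mean of \<open>\<bar>p\<hat>(c *s y)\<bar>\<^sup>2\<close> over the nonzero scalars \<open>c\<close>. As dual codes are closed under
  scaling, it replaces the Fourier transform \<open>p\<hat>\<close> of \<open>p\<close>, and no characters are needed.\<close>

definition line_weight :: "(('k::{field,finite})^'n \<Rightarrow> real) \<Rightarrow> 'k^'n \<Rightarrow> real" where
  "line_weight p y = (real CARD('k) * (\<Sum>t\<in>UNIV. (\<Sum>a | dot y a = t. p a)\<^sup>2) - (\<Sum>a\<in>UNIV. p a)\<^sup>2)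
     / (real CARD('k) - 1)"

text \<open>Cauchy-Schwarz over the \<open>CARD('k)\<close> values of \<open>dot y\<close>. The sign
  allows probabilities to be bounded frequency by frequency.\<close>

lemma line_weight_nonneg: "0 \<le> line_weight p (y :: ('k::{field,finite})^'n)"
proof -
  have "(\<Sum>a\<in>UNIV. p a) = (\<Sum>t\<in>UNIV. \<Sum>a | dot y a = t. p a)"
    using sum.group[of "UNIV :: ('k^'n) set" UNIV "dot y" p] by simp
  then have "(\<Sum>a\<in>UNIV. p a)\<^sup>2 \<le> real CARD('k) * (\<Sum>t\<in>UNIV. (\<Sum>a | dot y a = t. p a)\<^sup>2)"
    using sum_squared_le_sum_of_squares[of "\<lambda>t. \<Sum>a | dot y a = t. p a" UNIV]
    by (simp add: mult.commute)
  then show ?thesis using card_field_ge_2[where 'k = 'k] by (auto simp: line_weight_def)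
qed

lemma line_weight_0: "line_weight p (0 :: ('k::{field,finite})^'n) = (\<Sum>a\<in>UNIV. p a)\<^sup>2"
proof -
  have "(\<Sum>t\<in>(UNIV::'k set). (\<Sum>a | dot (0::'k^'n) a = t. p a)\<^sup>2)
      = (\<Sum>t\<in>(UNIV::'k set). if t = 0 then (\<Sum>a\<in>UNIV. p a)\<^sup>2 else 0)"
    by (intro sum.cong) auto
  also have "\<dots> = (\<Sum>a\<in>UNIV. p a)\<^sup>2" by simp
  finally show ?thesis
    using card_field_ge_2[where 'k = 'k] by (simp add: line_weight_def field_simps)
qed

text \<open>As a quadratic form in \<open>p\<close>, the weight depends on \<open>y\<close> only
  through the kernel \<open>ramanujan\<close>, so summing over a code acts on that kernel
  alone.\<close>

lemma line_weight_alt: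
  fixes y :: "('k::{field,finite})^'n"
  shows "line_weight p y = (\<Sum>a\<in>UNIV. \<Sum>a'\<in>UNIV. p a * p a' * ramanujan (dot y (a - a')))
     / (real CARD('k) - 1)"
proof -
  have "(\<Sum>a\<in>UNIV. p a)\<^sup>2 = (\<Sum>a\<in>UNIV. \<Sum>a'\<in>UNIV. p a * p a')"
    by (simp add: power2_eq_square sum_product)
  then have "real CARD('k) * (\<Sum>t\<in>UNIV. (\<Sum>a | dot y a = t. p a)\<^sup>2) - (\<Sum>a\<in>UNIV. p a)\<^sup>2
      = (\<Sum>a\<in>UNIV. \<Sum>a'\<in>UNIV. real CARD('k) * (p a * p a' * (if dot y a = dot y a' then 1 else 0))
           - p a * p a')"
    by (simp only: sum_fibre_squared sum_distrib_left sum_subtractf)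
  also have "\<dots> = (\<Sum>a\<in>UNIV. \<Sum>a'\<in>UNIV. p a * p a' * ramanujan (dot y (a - a')))"
    by (intro sum.cong refl) (auto simp: ramanujan_def dot_diff_right algebra_simps)
  finally show ?thesis by (simp add: line_weight_def)
qed

text \<open>A form of Poisson summation: once the sums are exchanged,
  \<open>sum_ramanujan_dual\<close> at \<open>a - a'\<close> selects exactly the pairs with
  \<open>f a = f a'\<close>.\<close>

lemma collision_eq_line_weights:
  fixes f :: "('k::{field,finite})^'n \<Rightarrow> 'k^'m" and p :: "'k^'n \<Rightarrow> real"
  assumes lin: "Vector_Spaces.linear (*s) (*s) f"
  shows "card (range f) * (\<Sum>b\<in>UNIV. (\<Sum>a | f a = b. p a)\<^sup>2)
    = (\<Sum>y\<in>dual_code (ker_code f). line_weight p y)"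
proof -
  interpret f: Vector_Spaces.linear "(*s)" "(*s)" f by (rule lin)
  let ?q = "real CARD('k)" and ?D = "dual_code (ker_code f)"
  have q: "?q > 1" using card_field_ge_2[where 'k = 'k] by linarith
  have "(?q - 1) * (\<Sum>y\<in>?D. line_weight p y)
      = (\<Sum>y\<in>?D. \<Sum>a\<in>UNIV. \<Sum>a'\<in>UNIV. p a * p a' * ramanujan (dot y (a - a')))"
    using q by (simp add: line_weight_alt flip: sum_divide_distrib)
  also have "\<dots> = (\<Sum>a\<in>UNIV. \<Sum>a'\<in>UNIV. \<Sum>y\<in>?D. p a * p a' * ramanujan (dot y (a - a')))"
    by (subst sum.swap, rule sum.cong[OF refl], subst sum.swap) simp
  also have "\<dots> = (\<Sum>a\<in>UNIV. \<Sum>a'\<in>UNIV.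
      (?q - 1) * (card (range f) * (p a * p a' * (if f a = f a' then 1 else 0))))"
    by (intro sum.cong refl)
       (auto simp: sum_ramanujan_dual[OF lin] f.diff simp flip: sum_distrib_left)
  also have "\<dots> = (?q - 1) * (card (range f) * (\<Sum>b\<in>UNIV. (\<Sum>a | f a = b. p a)\<^sup>2))"
    unfolding sum_fibre_squared sum_distrib_left ..
  finally show ?thesis using q by simp
qed

text \<open>Parseval's identity, obtained from the identity map: its kernel is trivial, so its dual
  code is the whole space.\<close>

lemma sum_line_weight:
  fixes p :: "('k::{field,finite})^'n \<Rightarrow> real"
  shows "(\<Sum>y\<in>UNIV. line_weight p y) = CARD('k^'n) * (\<Sum>a\<in>UNIV. (p a)\<^sup>2)"
proof -
  have "Vector_Spaces.linear (*s) (*s) (\<lambda>x::'k^'n. x)"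
    by (rule vec.linear_ident)
  from collision_eq_line_weights[OF this, of p]
  show ?thesis by (simp add: dual_code_def ker_code_def dot_def[symmetric])
qed

section \<open>The expected information of the hash value\<close>

text \<open>The sample space may be infinite, but \<open>g\<close> takes finitely many values, so
  the function is bounded. In the applications \<open>g\<close> is the random hash map, an element
  of a finite function type.\<close>

lemma integrable_finite_range:
  fixes G :: "'y::finite \<Rightarrow> real"
  shows "integrable (measure_pmf X) (\<lambda>x. G (g x))"
proof (rule measure_pmf.integrable_const_bound[where B = "Max (range (\<lambda>y. \<bar>G y\<bar>))"])
  show "AE x in measure_pmf X. norm (G (g x)) \<le> Max (range (\<lambda>y. \<bar>G y\<bar>))"
    by (intro AE_I2) simp
qed simp

lemma universal2_nonneg:
  fixes f :: "'x \<Rightarrow> ('k::{field,finite})^'n \<Rightarrow> 'k^'m"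
  assumes "almost_dual_universal2 \<epsilon> X f"
  shows "0 \<le> \<epsilon>"
proof -
  have pos: "0 < real CARD('k) powi (int CARD('m) - int CARD('n))"
    using card_field_ge_2[where 'k = 'k] by (intro zero_less_power_int) simp
  have "axis undefined 1 \<noteq> (0 :: 'k^'n)" by (simp add: axis_eq_0_iff)
  with assms have "measure_pmf.prob X {x. axis undefined 1 \<in> dual_code (ker_code (f x))}
      \<le> \<epsilon> * real CARD('k) powi (int CARD('m) - int CARD('n))"
    unfolding almost_dual_universal2_def by blast
  then have "0 \<le> \<epsilon> * real CARD('k) powi (int CARD('m) - int CARD('n))"
    by (rule order_trans[OF measure_nonneg])
  with pos show ?thesis by (metis not_le zero_le_mult_iff)
qed

lemma expectation_collision_le:
  fixes f :: "'x \<Rightarrow> ('k::{field,finite})^'n \<Rightarrow> 'k^'m" and p :: "'k^'n \<Rightarrow> real"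
  assumes lin: "linear_hash X f" and uni: "almost_dual_universal2 \<epsilon> X f"
  shows "measure_pmf.expectation X (\<lambda>x. card (range (f x)) * (\<Sum>b\<in>UNIV. (\<Sum>a | f x a = b. p a)\<^sup>2))
    \<le> (\<Sum>a\<in>UNIV. p a)\<^sup>2 + \<epsilon> * real CARD('k) ^ CARD('m) * (\<Sum>a\<in>UNIV. (p a)\<^sup>2)"
proof -
  let ?r = "\<epsilon> * real CARD('k) powi (int CARD('m) - int CARD('n))"
  let ?pr = "\<lambda>y. measure_pmf.prob X {x. y \<in> dual_code (ker_code (f x))}"
  have k: "real CARD('k) > 0" by simp
  have "measure_pmf.expectation X (\<lambda>x. card (range (f x)) * (\<Sum>b\<in>UNIV. (\<Sum>a | f x a = b. p a)\<^sup>2))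
      = measure_pmf.expectation X
          (\<lambda>x. \<Sum>y\<in>UNIV. line_weight p y * indicator {x. y \<in> dual_code (ker_code (f x))} x)"
  proof (intro integral_cong_AE AE_pmfI)
    fix x assume "x \<in> set_pmf X"
    with lin have "Vector_Spaces.linear (*s) (*s) (f x)" by (simp add: linear_hash_def)
    from collision_eq_line_weights[OF this, of p]
    show "card (range (f x)) * (\<Sum>b\<in>UNIV. (\<Sum>a | f x a = b. p a)\<^sup>2)
        = (\<Sum>y\<in>UNIV. line_weight p y * indicator {x. y \<in> dual_code (ker_code (f x))} x)"
      by (simp add: indicator_def if_distrib sum.If_cases cong: if_cong)
  qed simp_all
  also have "\<dots> = (\<Sum>y\<in>UNIV. line_weight p y * ?pr y)"
  proof (subst Bochner_Integration.integral_sum)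
    show "integrable X (\<lambda>x. line_weight p y * indicator {x. y \<in> dual_code (ker_code (f x))} x)" for y
      using integrable_finite_range[of X
          "\<lambda>h. line_weight p y * indicator {h. y \<in> dual_code (ker_code h)} h" f]
      by (simp add: indicator_def)
  qed simp
  \<comment> \<open>At \<open>y = 0\<close> the trivial bound 1 on the probability is used. The
    additional summand \<open>line_weight p 0 * ?r\<close> is nonnegative and completes the sum to
    that of Parseval's identity.\<close>
  also have "\<dots> \<le> (\<Sum>y\<in>UNIV. (if y = 0 then line_weight p y else 0) + line_weight p y * ?r)"
  proof (rule sum_mono)
    fix y :: "'k^'n"
    have r: "0 \<le> ?r" using universal2_nonneg[OF uni] by simp
    have "?pr y \<le> ?r" if "y \<noteq> 0" using uni that by (simp add: almost_dual_universal2_def)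
    moreover have "?pr y \<le> 1" by simp
    ultimately show "line_weight p y * ?pr y
        \<le> (if y = 0 then line_weight p y else 0) + line_weight p y * ?r"
      using line_weight_nonneg[of p y] mult_left_mono[of "?pr y" 1 "line_weight p y"]
        mult_left_mono[of "?pr y" ?r "line_weight p y"] mult_nonneg_nonneg[OF _ r]
      by (auto intro: add_increasing2)
  qed
  also have "\<dots> = (\<Sum>a\<in>UNIV. p a)\<^sup>2 + ?r * (CARD('k^'n) * (\<Sum>a\<in>UNIV. (p a)\<^sup>2))"
    by (simp add: sum.distrib line_weight_0 mult.commute sum_line_weight[simplified] flip: sum_distrib_right)
  also have "\<dots> = (\<Sum>a\<in>UNIV. p a)\<^sup>2 + \<epsilon> * real CARD('k) ^ CARD('m) * (\<Sum>a\<in>UNIV. (p a)\<^sup>2)"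
    using k by (simp add: power_int_diff)
  finally show ?thesis .
qed

section \<open>Inequalities for the logarithm\<close>

text \<open>Apply \<open>ln u \<le> u - 1\<close> to each quotient separately; the two errors add up
  to at most 0. The implications make a term with zero denominator vanish.\<close>

lemma log_sum_two:
  fixes A B \<alpha> \<beta> :: real
  assumes "0 \<le> A" "0 \<le> B" "0 \<le> \<alpha>" "0 \<le> \<beta>" "\<alpha> = 0 \<Longrightarrow> A = 0" "\<beta> = 0 \<Longrightarrow> B = 0"
  shows "(A + B) * ln ((A + B) / (\<alpha> + \<beta>)) \<le> A * ln (A / \<alpha>) + B * ln (B / \<beta>)"
proof -
  have *: "A * ln ((A + B) / (\<alpha> + \<beta>)) - A * ln (A / \<alpha>) \<le> (A + B) * \<alpha> / (\<alpha> + \<beta>) - A"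
    if "0 \<le> A" "0 \<le> B" "0 \<le> \<alpha>" "0 \<le> \<beta>" "\<alpha> = 0 \<Longrightarrow> A = 0" for A B \<alpha> \<beta> :: real
  proof (cases "A = 0")
    case False
    with that have pos: "A > 0" "\<alpha> > 0" by force+
    then have "ln ((A + B) / (\<alpha> + \<beta>)) - ln (A / \<alpha>) = ln ((A + B) / (\<alpha> + \<beta>) / (A / \<alpha>))"
      using that ln_div[of "(A + B) / (\<alpha> + \<beta>)" "A / \<alpha>"] by auto
    also have "\<dots> \<le> (A + B) / (\<alpha> + \<beta>) / (A / \<alpha>) - 1"
      using pos that by (intro ln_le_minus_one) (auto intro!: divide_pos_pos add_pos_nonneg)
    finally have "A * (ln ((A + B) / (\<alpha> + \<beta>)) - ln (A / \<alpha>))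
        \<le> A * ((A + B) / (\<alpha> + \<beta>) / (A / \<alpha>) - 1)"
      using pos by (intro mult_left_mono) auto
    also have "\<dots> = (A + B) * \<alpha> / (\<alpha> + \<beta>) - A"
      using pos by (simp add: right_diff_distrib)
    finally show ?thesis by (simp add: right_diff_distrib)
  qed (use that in auto)
  have "(A + B) * \<alpha> / (\<alpha> + \<beta>) + (B + A) * \<beta> / (\<beta> + \<alpha>) \<le> A + B"
  proof (cases "\<alpha> + \<beta> = 0")
    case False
    then have "(A + B) * \<alpha> / (\<alpha> + \<beta>) + (B + A) * \<beta> / (\<beta> + \<alpha>) = (A + B) * (\<alpha> + \<beta>) / (\<alpha> + \<beta>)"
      by (simp only: add.commute[of \<beta> \<alpha>] add.commute[of B A] distrib_left add_divide_distrib)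
    with False show ?thesis by simp
  qed (use assms in simp)
  with *[of A B \<alpha> \<beta>] *[of B A \<beta> \<alpha>] assms show ?thesis
    by (simp add: algebra_simps)
qed

text \<open>The log sum inequality splits \<open>Q b\<close> into \<open>Q' b\<close>, of total mass
  \<open>v\<close>, and a remainder of total mass \<open>w - v\<close> whose term is at most 0. The
  tangent point \<open>t\<close> of \<open>ln\<close> stays free so that it can be fitted to an
  average over hashes.\<close>

lemma relative_entropy_le:
  fixes Q Q' :: "'b::finite \<Rightarrow> real"
  assumes Q: "\<And>b. 0 \<le> Q' b" "\<And>b. Q' b \<le> Q b" and t: "0 < t"
  defines "w \<equiv> \<Sum>b\<in>UNIV. Q b" and "v \<equiv> \<Sum>b\<in>UNIV. Q' b"
  shows "(\<Sum>b\<in>UNIV. Q b * ln (Q b / w)) \<le> v * (ln t - 1) + (\<Sum>b\<in>UNIV. (Q' b)\<^sup>2) / (v * t)"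
proof -
  have v0: "0 \<le> v" unfolding v_def by (intro sum_nonneg Q)
  have R: "0 \<le> Q b - Q' b" "Q b - Q' b \<le> w - v" for b
    using Q member_le_sum[of b UNIV "\<lambda>b. Q b - Q' b"]
    by (auto simp: w_def v_def sum_subtractf)
  have wv: "0 \<le> w - v" using R[of undefined] by linarith
  have Q'_le: "Q' b \<le> v" for b unfolding v_def using Q by (intro member_le_sum) auto
  have "Q b * ln (Q b / w) \<le> Q' b * (ln t - 1) + (Q' b)\<^sup>2 / (v * t)" for b
  proof -
    have "Q b * ln (Q b / w) \<le> Q' b * ln (Q' b / v) + (Q b - Q' b) * ln ((Q b - Q' b) / (w - v))"
      using log_sum_two[of "Q' b" "Q b - Q' b" v "w - v"] Q(1)[of b] R[of b] Q'_le[of b] v0 wv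
      by simp
    also have "(Q b - Q' b) * ln ((Q b - Q' b) / (w - v)) \<le> 0"
    proof (cases "Q b - Q' b = 0")
      case False
      with R[of b] have "0 < Q b - Q' b" "0 < w - v" by linarith+
      then show ?thesis using R[of b] by (intro mult_nonneg_nonpos) simp_all
    qed simp
    also have "Q' b * ln (Q' b / v) \<le> Q' b * (ln t - 1) + (Q' b)\<^sup>2 / (v * t)"
    proof (cases "Q' b = 0")
      case False
      with Q(1)[of b] Q'_le[of b] have pos: "Q' b > 0" "v > 0" by linarith+
      \<comment> \<open>Replacing \<open>ln\<close> by its tangent at \<open>t\<close> makes the
        bound quadratic in \<open>Q' b\<close>, hence a collision mass.\<close>
      have "ln (Q' b / v) = ln t + ln (Q' b / v / t)"
        using pos t ln_div[of "Q' b / v" t] by auto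
      also have "ln (Q' b / v / t) \<le> Q' b / v / t - 1"
        using pos t by (intro ln_le_minus_one) auto
      finally have "Q' b * ln (Q' b / v) \<le> Q' b * (ln t + (Q' b / v / t - 1))"
        using pos by (intro mult_left_mono) auto
      then show ?thesis by (simp add: algebra_simps power2_eq_square)
    qed simp
    finally show ?thesis by simp
  qed
  then have "(\<Sum>b\<in>UNIV. Q b * ln (Q b / w))
      \<le> (\<Sum>b\<in>UNIV. Q' b * (ln t - 1) + (Q' b)\<^sup>2 / (v * t))"
    by (intro sum_mono)
  then show ?thesis
    by (simp add: sum.distrib v_def sum_divide_distrib flip: sum_distrib_right)
qed

text \<open>Concavity of \<open>ln\<close> between \<open>1\<close> and \<open>1 + x / c\<close>
  with weight \<open>c\<close>, where \<open>ln 1 = 0\<close>.\<close>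

lemma mult_ln_one_plus_divide_le:
  fixes c x :: real
  assumes "0 < c" "c \<le> 1" "0 \<le> x"
  shows "c * ln (1 + x / c) \<le> ln (1 + x)"
proof -
  have "convex_on {0<..} (\<lambda>x. - ln x :: real)"
    by (rule convex_on_realI[where f' = "\<lambda>x. - (1 / x)"])
       (auto intro!: derivative_eq_intros simp: field_simps)
  from convex_onD[OF this, of c 1 "1 + x / c"] assms
  show ?thesis by (simp add: algebra_simps add_pos_nonneg)
qed

section \<open>Information of one hash and its average\<close>

lemma sum_hashed: "(\<Sum>b\<in>UNIV. hashed f P b e) = marg P e" for f :: "'a::finite \<Rightarrow> 'b::finite"
  using sum.group[of UNIV UNIV f "\<lambda>a. P a e"] by (simp add: hashed_def marg_def)

lemma sum_marg: "prob_dist P \<Longrightarrow> (\<Sum>e\<in>UNIV. marg P e) = 1"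
  unfolding prob_dist_def marg_def by (subst sum.swap) simp

text \<open>The tangent point for \<open>e\<close> is \<open>s e / card (range h)\<close>, which
  turns the squares into the collision mass normalised by the size of the range. The price for a
  range smaller than the whole codomain is the second summand.\<close>

lemma I'_le:
  fixes h :: "'a::finite \<Rightarrow> 'b::finite" and P P' :: "'a \<Rightarrow> 'e::finite \<Rightarrow> real" and s :: "'e \<Rightarrow> real"
  assumes P: "prob_dist P" and P': "\<And>a e. 0 \<le> P' a e" "\<And>a e. P' a e \<le> P a e"
    and s: "\<And>e. 0 < s e"
  shows "I' h P \<le> (1 - (\<Sum>e\<in>UNIV. marg P' e)) * ln (real CARD('b))
     + ln (real CARD('b) / card (range h))
     + (\<Sum>e\<in>UNIV. marg P' e * (ln (s e) - 1)
         + card (range h) * (\<Sum>b\<in>UNIV. (hashed h P' b e)\<^sup>2) / (marg P' e * s e))"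
proof -
  define L where "L = real (card (range h))"
  define M where "M = real CARD('b)"
  define V where "V = (\<Sum>e\<in>UNIV. marg P' e)"
  have "card (range h) > 0" by (simp add: card_gt_0_iff)
  then have L: "1 \<le> L" by (simp add: L_def)
  have LM: "L \<le> M" by (simp add: L_def M_def card_mono)
  have h0: "0 \<le> hashed h P' b e" "hashed h P' b e \<le> hashed h P b e" for b e
    using P' by (auto simp: hashed_def intro: sum_nonneg sum_mono)
  have sum1: "(\<Sum>e\<in>UNIV. marg P e) = 1"
    by (rule sum_marg[OF P])
  have V: "V \<le> 1"
    unfolding V_def sum1[symmetric] marg_def by (intro sum_mono P')
  \<comment> \<open>The logarithm of the product splits only for a positive hashed value, which also
    forces \<open>marg P e\<close> to be positive; at 0 both sides vanish.\<close>
  have ln_split: "hashed h P b e * ln (M * hashed h P b e / marg P e)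
      = hashed h P b e * ln M + hashed h P b e * ln (hashed h P b e / marg P e)" for b e
  proof (cases "hashed h P b e = 0")
    case False
    then have pos: "hashed h P b e > 0" using h0[of b e] by linarith
    moreover have "hashed h P b e \<le> marg P e"
      unfolding sum_hashed[of h P e, symmetric] using h0
      by (intro member_le_sum) (auto intro: order_trans[OF h0])
    ultimately show ?thesis using L LM by (simp add: ln_mult ln_div algebra_simps)
  qed simp
  have "I' h P = (\<Sum>e\<in>UNIV. \<Sum>b\<in>UNIV. hashed h P b e * ln (M * hashed h P b e / marg P e))"
    unfolding I'_def M_def by (rule sum.swap)
  also have "\<dots> = ln M + (\<Sum>e\<in>UNIV. \<Sum>b\<in>UNIV. hashed h P b e * ln (hashed h P b e / marg P e))"
    by (simp add: ln_split sum.distrib sum_hashed sum1 flip: sum_distrib_right)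
  also have "\<dots> \<le> ln M + (\<Sum>e\<in>UNIV. marg P' e * (ln (s e / L) - 1)
      + (\<Sum>b\<in>UNIV. (hashed h P' b e)\<^sup>2) / (marg P' e * (s e / L)))"
  proof (intro add_left_mono sum_mono)
    fix e
    have "0 < s e / L" using s[of e] L by simp
    from relative_entropy_le[of "\<lambda>b. hashed h P' b e" "\<lambda>b. hashed h P b e", OF h0 this]
    show "(\<Sum>b\<in>UNIV. hashed h P b e * ln (hashed h P b e / marg P e))
        \<le> marg P' e * (ln (s e / L) - 1)
          + (\<Sum>b\<in>UNIV. (hashed h P' b e)\<^sup>2) / (marg P' e * (s e / L))"
      by (simp only: sum_hashed)
  qed
  also have "\<dots> = ln M - V * ln L + (\<Sum>e\<in>UNIV. marg P' e * (ln (s e) - 1)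
         + L * (\<Sum>b\<in>UNIV. (hashed h P' b e)\<^sup>2) / (marg P' e * s e))"
  proof -
    have "marg P' e * (ln (s e / L) - 1) = marg P' e * (ln (s e) - 1) - marg P' e * ln L" for e
      using s[of e] L by (simp add: ln_div algebra_simps)
    then show ?thesis
      by (simp add: sum.distrib sum_subtractf V_def mult.commute sum_distrib_left)
  qed
  also have "ln M - V * ln L \<le> (1 - V) * ln M + ln (M / L)"
  proof -
    have "V * (ln M - ln L) \<le> 1 * (ln M - ln L)"
      using V L LM by (intro mult_right_mono) auto
    then show ?thesis using L LM by (simp add: ln_div algebra_simps)
  qed
  finally show ?thesis by (simp add: L_def M_def V_def)
qed

text \<open>Since the tangent has replaced \<open>ln\<close>, the collision mass enters linearly and
  may be averaged over \<open>X\<close>; the tangent points depend on \<open>e\<close> but not on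
  the hash.\<close>

lemma expectation_I'_le_minor:
  fixes P P' :: "('k::{field,finite})^'n \<Rightarrow> 'e::finite \<Rightarrow> real"
    and f :: "'x \<Rightarrow> 'k^'n \<Rightarrow> 'k^'m"
  assumes P: "prob_dist P" and lin: "linear_hash X f" and uni: "almost_dual_universal2 \<epsilon> X f"
    and M: "M = real CARD('k) ^ CARD('m)"
    and P': "\<And>a e. 0 \<le> P' a e" "\<And>a e. P' a e \<le> P a e"
    and g: "0 \<le> g" "\<And>a e. P' a e \<le> g * marg P e"
  shows "measure_pmf.expectation X (\<lambda>x. I' (f x) P)
    \<le> (1 - (\<Sum>e\<in>UNIV. marg P' e)) * ln M + ln (1 + \<epsilon> * M * g)
       + measure_pmf.expectation X (\<lambda>x. ln (M / card (range (f x))))"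
proof -
  let ?E = "measure_pmf.expectation X"
  define v w where "v = marg P'" and "w = marg P"
  \<comment> \<open>This is the bound on the expected collision mass divided by
    \<open>(v e)\<^sup>2\<close>. With it the quadratic term is at most \<open>v e\<close> and
    cancels the \<open>- v e\<close> of the tangent. If \<open>v e = 0\<close>, the quotient is 0
    and \<open>s e = 1\<close>.\<close>
  define s where "s e = 1 + \<epsilon> * M * g * w e / v e" for e
  define K where "K x e = card (range (f x)) * (\<Sum>b\<in>UNIV. (hashed (f x) P' b e)\<^sup>2)" for x e
  have card_M: "real CARD('k^'m) = M" by (simp add: M)
  have \<epsilon>M: "0 \<le> \<epsilon> * M" using universal2_nonneg[OF uni] by (simp add: M)
  have v: "0 \<le> v e" "v e \<le> w e" for e
    using P' by (auto simp: v_def w_def marg_def intro: sum_nonneg sum_mono)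
  have w1: "(\<Sum>e\<in>UNIV. w e) = 1"
    unfolding w_def by (rule sum_marg[OF P])
  have w0: "0 \<le> w e" for e using v[of e] by linarith
  have s: "0 < s e" for e
    unfolding s_def using \<epsilon>M g(1) v[of e] w0[of e] by (intro add_pos_nonneg) auto
  have int: "integrable X (\<lambda>x. G (f x))" for G :: "_ \<Rightarrow> real"
    by (rule integrable_finite_range[of X G f])
  have EK: "v e * (ln (s e) - 1) + ?E (\<lambda>x. K x e) / (v e * s e) \<le> w e * ln (1 + \<epsilon> * M * g)" for e
  proof (cases "v e = 0")
    case True
    then show ?thesis using w0[of e] \<epsilon>M g by simp
  next
    case False
    with v[of e] have pos: "0 < v e" "0 < w e" by linarith+
    \<comment> \<open>One factor of each square is replaced by its bound
      \<open>g * w e\<close>.\<close>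
    have "(\<Sum>a\<in>UNIV. (P' a e)\<^sup>2) \<le> (\<Sum>a\<in>UNIV. P' a e * (g * w e))"
      unfolding power2_eq_square w_def by (intro sum_mono mult_left_mono g P')
    also have "\<dots> = v e * (g * w e)" by (simp add: v_def marg_def sum_distrib_right)
    finally have "\<epsilon> * M * (\<Sum>a\<in>UNIV. (P' a e)\<^sup>2) \<le> \<epsilon> * M * (v e * (g * w e))"
      by (intro mult_left_mono \<epsilon>M)
    moreover have "?E (\<lambda>x. K x e) \<le> (v e)\<^sup>2 + \<epsilon> * M * (\<Sum>a\<in>UNIV. (P' a e)\<^sup>2)"
      using expectation_collision_le[OF lin uni, of "\<lambda>a. P' a e"]
      by (simp add: K_def hashed_def v_def marg_def M)
    ultimately have "?E (\<lambda>x. K x e) \<le> (v e)\<^sup>2 + \<epsilon> * M * (v e * (g * w e))" by linarith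
    also have "\<dots> = v e * (v e * s e)"
      using pos by (simp add: s_def field_simps power2_eq_square)
    finally have "?E (\<lambda>x. K x e) / (v e * s e) \<le> v e"
      using pos s[of e] by (simp add: divide_le_eq)
    moreover have "v e * ln (s e) \<le> w e * ln (1 + \<epsilon> * M * g)"
    proof -
      \<comment> \<open>Concavity with \<open>c = v e / w e\<close> trades the weight
        \<open>v e\<close> for \<open>w e\<close>, and the weights \<open>w e\<close> sum to
        1.\<close>
      have "v e / w e * ln (1 + \<epsilon> * M * g / (v e / w e)) \<le> ln (1 + \<epsilon> * M * g)"
        using pos v[of e] \<epsilon>M g by (intro mult_ln_one_plus_divide_le) auto
      then have "w e * (v e / w e * ln (1 + \<epsilon> * M * g / (v e / w e))) \<le> w e * ln (1 + \<epsilon> * M * g)"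
        using pos by (intro mult_left_mono) auto
      then show ?thesis using pos by (simp add: s_def)
    qed
    ultimately show ?thesis by (simp add: algebra_simps)
  qed
  have "?E (\<lambda>x. I' (f x) P) \<le> ?E (\<lambda>x. (1 - (\<Sum>e\<in>UNIV. v e)) * ln M + ln (M / card (range (f x)))
      + (\<Sum>e\<in>UNIV. v e * (ln (s e) - 1) + K x e / (v e * s e)))"
  proof (rule integral_mono)
    fix x
    show "I' (f x) P \<le> (1 - (\<Sum>e\<in>UNIV. v e)) * ln M + ln (M / card (range (f x)))
        + (\<Sum>e\<in>UNIV. v e * (ln (s e) - 1) + K x e / (v e * s e))"
      using I'_le[of P P' s "f x", OF P P' s] unfolding card_M by (simp add: v_def K_def)
    show "integrable X (\<lambda>x. I' (f x) P)" by (rule int[of "\<lambda>h. I' h P"])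
    show "integrable X (\<lambda>x. (1 - (\<Sum>e\<in>UNIV. v e)) * ln M + ln (M / card (range (f x)))
        + (\<Sum>e\<in>UNIV. v e * (ln (s e) - 1) + K x e / (v e * s e)))"
      unfolding K_def
      by (rule int[of "\<lambda>h. (1 - (\<Sum>e\<in>UNIV. v e)) * ln M + ln (M / card (range h))
        + (\<Sum>e\<in>UNIV. v e * (ln (s e) - 1)
            + card (range h) * (\<Sum>b\<in>UNIV. (hashed h P' b e)\<^sup>2) / (v e * s e))"])
  qed
  also have "\<dots> = (1 - (\<Sum>e\<in>UNIV. v e)) * ln M + ?E (\<lambda>x. ln (M / card (range (f x))))
      + (\<Sum>e\<in>UNIV. v e * (ln (s e) - 1) + ?E (\<lambda>x. K x e) / (v e * s e))"
  proof -
    have 1: "integrable X (\<lambda>x. ln (M / card (range (f x))))" 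
      by (rule int[of "\<lambda>h. ln (M / card (range h))"])
    have 2: "integrable X (\<lambda>x. K x e)" for e unfolding K_def
      by (rule int[of "\<lambda>h. card (range h) * (\<Sum>b\<in>UNIV. (hashed h P' b e)\<^sup>2)"])
    show ?thesis using 1 2 by simp
  qed
  also have "(\<Sum>e\<in>UNIV. v e * (ln (s e) - 1) + ?E (\<lambda>x. K x e) / (v e * s e))
      \<le> (\<Sum>e\<in>UNIV. w e * ln (1 + \<epsilon> * M * g))"
    by (intro sum_mono EK)
  also have "\<dots> = ln (1 + \<epsilon> * M * g)"
    by (simp add: w1 flip: sum_distrib_right)
  finally show ?thesis by (simp add: v_def)
qed

section \<open>The three forms of the bound\<close>

lemma exp_neg_nonneg: "0 \<le> exp_neg h"
  by (simp add: exp_neg_def)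

text \<open>At \<open>-\<infinity>\<close> the function has the default value 1, which would break
  the order reversal.\<close>

lemma exp_neg_le_iff: "h \<noteq> -\<infinity> \<Longrightarrow> exp_neg h \<le> exp (- r) \<longleftrightarrow> ereal r \<le> h"
  by (cases h) (auto simp: exp_neg_def)

lemma exp_neg_antimono: "h \<noteq> -\<infinity> \<Longrightarrow> h \<le> h' \<Longrightarrow> exp_neg h' \<le> exp_neg h"
  by (cases h; cases h') (auto simp: exp_neg_def)

text \<open>A strict lower bound on a supremum lets a member above it be chosen; this provides one
  for \<open>Hmin_down\<close>.\<close>

lemma less_of_exp_neg_less:
  assumes "h \<noteq> -\<infinity>" "exp_neg h < t"
  shows "ereal (- ln t) < h"
proof -
  have t: "0 < t" using assms(2) exp_neg_nonneg[of h] by linarith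
  show ?thesis
  proof (cases h)
    case (real r)
    with assms(2) have "exp (- r) < t" by (simp add: exp_neg_def)
    then have "ln (exp (- r)) < ln t" using t by (subst ln_less_cancel_iff) auto
    then show ?thesis using real by simp
  qed (use assms in auto)
qed

lemma Hmin_not_MInf [simp]: "Hmin P' Q \<noteq> -\<infinity>"
  by (simp add: Hmin_def Let_def)

lemma exp_neg_Hmin:
  assumes "0 \<le> Max ((\<lambda>(a, e). P' a e / Q e) ` {(a, e). 0 < Q e})"
  shows "exp_neg (Hmin P' Q) = Max ((\<lambda>(a, e). P' a e / Q e) ` {(a, e). 0 < Q e})"
  using assms by (simp add: Hmin_def exp_neg_def Let_def)

lemma marg_pos_ex:
  assumes "prob_dist P"
  obtains e where "0 < marg P e"
proof -
  have "\<not> (\<forall>e. marg P e \<le> 0)"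
    using sum_marg[OF assms] sum_nonpos[of UNIV "marg P"] by auto
  then show ?thesis using that by (auto simp: not_le)
qed

text \<open>Undoing the logarithm recovers the largest ratio to \<open>marg P e\<close>. Where the
  marginal is 0, domination forces \<open>P'\<close> to vanish as well.\<close>

lemma le_exp_neg_Hmin:
  assumes P: "prob_dist P" and P': "P' \<in> dominated_subs P"
  shows "P' a e \<le> exp_neg (Hmin P' (marg P)) * marg P e"
proof -
  have nn: "0 \<le> P' a e" for a e using P' by (simp add: dominated_subs_def sub_dist_def)
  have "P' a e \<le> marg P' e" unfolding marg_def by (intro member_le_sum nn) auto
  also have "\<dots> \<le> marg P e" using P' by (simp add: dominated_subs_def)
  finally have le: "P' a e \<le> marg P e" .
  show ?thesis
  proof (cases "marg P e = 0")
    case False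
    with le nn[of a e] have pos: "0 < marg P e" by linarith
    let ?S = "(\<lambda>(a, e). P' a e / marg P e) ` {(a, e). 0 < marg P e}"
    have *: "P' a e / marg P e \<le> Max ?S" using pos by (intro Max_ge) auto
    moreover have "0 \<le> P' a e / marg P e" using nn pos by simp
    ultimately have "exp_neg (Hmin P' (marg P)) = Max ?S" by (intro exp_neg_Hmin) linarith
    with * pos show ?thesis by (simp add: divide_le_eq)
  qed (use le in simp)
qed

lemma zero_dominated [simp]:
  "prob_dist P \<Longrightarrow> (\<lambda>_ _. 0) \<in> dominated_subs P"
  by (auto simp: dominated_subs_def sub_dist_def prob_dist_def marg_def intro: sum_nonneg)

lemma l1_dist_zero [simp]: "prob_dist P \<Longrightarrow> l1_dist P (\<lambda>_ _. 0) = 1"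
  by (simp add: l1_dist_def prob_dist_def)

lemma Hmin_zero [simp]:
  fixes P :: "'a::finite \<Rightarrow> 'e::finite \<Rightarrow> real"
  assumes "prob_dist P"
  shows "Hmin (\<lambda>(_ :: 'b::finite) _. 0) (marg P) = \<infinity>"
proof -
  obtain e where "0 < marg P e" using marg_pos_ex[OF assms] .
  then have "(\<lambda>(a, e). 0 / marg P e) ` {(a :: 'b, e). 0 < marg P e} = {0 :: real}" by auto
  then show ?thesis by (simp only: Hmin_def Let_def) simp
qed

lemma self_dominated: "prob_dist P \<Longrightarrow> P \<in> dominated_subs P"
  by (simp add: dominated_subs_def sub_dist_def prob_dist_def)

lemma l1_dist_self [simp]: "l1_dist P P = 0"
  by (simp add: l1_dist_def)

lemma l1_dist_nonneg [simp]: "0 \<le> l1_dist P P'"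
  by (simp add: l1_dist_def sum_nonneg)

lemma eta_0 [simp]: "eta 0 y = 0"
  by (simp add: eta_def)

section \<open>Shape and continuity of \<open>eta\<close>\<close>

lemma eta_1 [simp]: "eta 1 y = y"
  by (simp add: eta_def)

lemma mult_le_eta: "0 \<le> x \<Longrightarrow> x \<le> 1 \<Longrightarrow> x * y \<le> eta x y"
  by (cases "x = 0") (auto simp: eta_def mult_nonneg_nonpos)

text \<open>This absorbs a lost mass \<open>d\<close> into the \<open>eta\<close> term. Up to 1,
  \<open>- x * ln x\<close> is nonnegative; beyond 1, the smoothing radii are those with
  \<open>eta x (ln M)\<close> at least \<open>ln M\<close>.\<close>

lemma mult_le_eta_radius:
  assumes "0 \<le> d" "d \<le> 1" "d \<le> x" "x \<in> smoothing_radius M" "1 \<le> M"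
  shows "d * ln M \<le> eta x (ln M)"
proof (cases "x \<le> 1")
  case True
  have "d * ln M \<le> x * ln M" using assms by (intro mult_right_mono) auto
  also have "\<dots> \<le> eta x (ln M)" using True assms by (intro mult_le_eta) auto
  finally show ?thesis .
next
  case False
  have "d * ln M \<le> 1 * ln M" using assms by (intro mult_right_mono) auto
  also have "\<dots> \<le> eta x (ln M)" using False assms(4) by (simp add: smoothing_radius_def)
  finally show ?thesis .
qed

text \<open>By concavity the chord from \<open>d\<close> to 1 lies below the graph at
  \<open>x\<close>. Its right end has height \<open>ln M\<close>, above the graph at
  \<open>x\<close>, so its left end must lie at or below it.\<close>

lemma eta_mono_below_ln:
  assumes "0 \<le> d" "d \<le> x" "x \<le> 1" "eta x (ln M) < ln M" "1 \<le> M"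
  shows "eta d (ln M) \<le> eta x (ln M)"
proof (cases "d = 0")
  case True
  \<comment> \<open>The convexity argument lives on the positive reals, so the endpoint 0 is settled
    by the sign of \<open>eta\<close>.\<close>
  have "0 \<le> x * ln M" using assms by simp
  also have "\<dots> \<le> eta x (ln M)" using assms by (intro mult_le_eta) auto
  finally show ?thesis using True by simp
next
  case False
  have x: "x < 1" using assms by (cases "x = 1") auto
  have conv: "convex_on {0<..} (\<lambda>x. - eta x (ln M))"
    by (rule convex_on_realI[where f' = "\<lambda>x. ln x + 1 - ln M"])
       (auto simp: eta_def intro!: derivative_eq_intros)
  \<comment> \<open>The weight that expresses \<open>x\<close> as the combination
    \<open>(1 - l) * d + l * 1\<close>.\<close>
  define l where "l = (x - d) / (1 - d)"
  have l: "0 \<le> l" "l < 1" using assms x by (simp_all add: l_def)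
  have "l * (1 - d) = x - d" using assms x by (simp add: l_def)
  then have lx: "(1 - l) * d + l = x" by (simp add: algebra_simps)
  from convex_onD[OF conv, of l d 1] l lx assms False
  have "(1 - l) * eta d (ln M) + l * ln M \<le> eta x (ln M)" by auto
  also have "\<dots> = (1 - l) * eta x (ln M) + l * eta x (ln M)" by (simp add: algebra_simps)
  also have "\<dots> \<le> (1 - l) * eta x (ln M) + l * ln M"
    using l assms by (intro add_left_mono mult_left_mono) auto
  finally show ?thesis using l by simp
qed

text \<open>Radii that are excluded or not attained are approached from above; at 0 this uses that
  \<open>t * ln t\<close> tends to 0.\<close>

lemma tendsto_eta_at_right:
  assumes "0 \<le> x"
  shows "((\<lambda>t. eta t y) \<longlongrightarrow> eta x y) (at_right x)"
proof (cases "x = 0")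
  case True
  have "((\<lambda>t. t * y - t * ln t) \<longlongrightarrow> 0) (at_right 0)" by real_asymp
  with True show ?thesis by (simp add: eta_def)
next
  case False
  then show ?thesis unfolding eta_def by (intro tendsto_intros) auto
qed

section \<open>Comparison of the infima\<close>

context
  fixes P :: "'a::finite \<Rightarrow> 'e::finite \<Rightarrow> real" and M \<epsilon> :: real
  assumes P: "prob_dist P" and M: "1 \<le> M" and eps: "0 \<le> \<epsilon>"
begin

lemma ln_cost_mono:
  "0 \<le> x \<Longrightarrow> x \<le> y \<Longrightarrow> ln (1 + \<epsilon> * M * x) \<le> ln (1 + \<epsilon> * M * y)"
  using M eps by (intro ln_mono) (auto intro!: mult_left_mono add_pos_nonneg)

lemma ln_cost_nonneg: "0 \<le> x \<Longrightarrow> 0 \<le> ln (1 + \<epsilon> * M * x)"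
  using M eps by simp

lemma tendsto_ln_cost:
  assumes "(g \<longlongrightarrow> x) F" "0 \<le> x"
  shows "((\<lambda>t. ln (1 + \<epsilon> * M * g t)) \<longlongrightarrow> ln (1 + \<epsilon> * M * x)) F"
proof -
  have "0 \<le> \<epsilon> * M * x" using M eps assms by simp
  then have "1 + \<epsilon> * M * x \<noteq> 0" by linarith
  then show ?thesis by (intro tendsto_intros assms)
qed

text \<open>The choice \<open>P' = 0\<close> has distance 1 and infinite min-entropy, so its cost is
  exactly \<open>ln M\<close>.\<close>

lemma Delta_min_le_ln: "Delta_min M \<epsilon> P \<le> ereal (ln M)"
  unfolding Delta_min_def
  by (rule INF_lower2[of "\<lambda>_ _. 0"]) (use P in \<open>simp_all add: smoothing_radius_def exp_neg_def\<close>)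

text \<open>Relaxing the distance to \<open>t\<close> and the ratio to \<open>\<tau>\<close> keeps
  an upper bound, although \<open>eta\<close> is not monotone: either \<open>eta t (ln M)\<close>
  reaches \<open>ln M\<close>, or \<open>t\<close> lies in the range where
  \<open>eta_mono_below_ln\<close> applies.\<close>

lemma Delta_min_le:
  assumes "t \<in> smoothing_radius M" "P' \<in> dominated_subs P" "l1_dist P P' \<le> t"
    and "exp_neg (Hmin P' (marg P)) \<le> \<tau>"
  shows "Delta_min M \<epsilon> P \<le> ereal (eta t (ln M) + ln (1 + \<epsilon> * M * \<tau>))"
proof (cases "ln M \<le> eta t (ln M)")
  case True
  have "0 \<le> \<tau>" using assms(4) exp_neg_nonneg order_trans by blast
  with True ln_cost_nonneg[of \<tau>] show ?thesis
    by (intro order_trans[OF Delta_min_le_ln]) simp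
next
  case False
  with assms(1) have t: "t \<le> 1" by (simp add: smoothing_radius_def)
  have "Delta_min M \<epsilon> P \<le> ereal (eta (l1_dist P P') (ln M)
      + ln (1 + \<epsilon> * M * exp_neg (Hmin P' (marg P))))"
    unfolding Delta_min_def using assms t by (intro INF_lower) (simp add: smoothing_radius_def)
  also have "\<dots> \<le> ereal (eta t (ln M) + ln (1 + \<epsilon> * M * \<tau>))"
    using eta_mono_below_ln[of "l1_dist P P'" t M] False t M assms
      ln_cost_mono[OF exp_neg_nonneg assms(4)] by simp
  finally show ?thesis .
qed

lemma Hmin_down_not_MInf:
  assumes "0 \<le> r"
  shows "Hmin_down r P \<noteq> -\<infinity>"
proof -
  have "Hmin P (marg P) \<le> Hmin_down r P"
    unfolding Hmin_down_def using assms self_dominated[OF P] by (intro SUP_upper) simp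
  then show ?thesis using Hmin_not_MInf[of P "marg P"] by auto
qed

lemma Delta_min_smooth_le:
  assumes "0 < t" "t \<in> smoothing_radius M" "P' \<in> dominated_subs P" "l1_dist P P' \<le> t"
  shows "Delta_min_smooth M \<epsilon> P
    \<le> ereal (eta t (ln M) + ln (1 + \<epsilon> * M * exp_neg (Hmin P' (marg P))))"
proof -
  have "Delta_min_smooth M \<epsilon> P \<le> ereal (eta t (ln M) + ln (1 + \<epsilon> * M * exp_neg (Hmin_down t P)))"
    unfolding Delta_min_smooth_def using assms by (intro INF_lower) simp
  also have "\<dots> \<le> ereal (eta t (ln M) + ln (1 + \<epsilon> * M * exp_neg (Hmin P' (marg P))))"
  proof -
    have "Hmin P' (marg P) \<le> Hmin_down t P"
      unfolding Hmin_down_def using assms by (intro SUP_upper) simp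
    then have "exp_neg (Hmin_down t P) \<le> exp_neg (Hmin P' (marg P))"
      by (intro exp_neg_antimono) simp_all
    from ln_cost_mono[OF exp_neg_nonneg this] show ?thesis by simp
  qed
  finally show ?thesis .
qed

lemma Delta_min_smooth_le_Delta_min: "Delta_min_smooth M \<epsilon> P \<le> Delta_min M \<epsilon> P"
  unfolding Delta_min_def
proof (rule INF_greatest)
  fix P' assume P': "P' \<in> {P' \<in> dominated_subs P. l1_dist P P' \<in> smoothing_radius M}"
  let ?c = "ln (1 + \<epsilon> * M * exp_neg (Hmin P' (marg P)))"
  show "Delta_min_smooth M \<epsilon> P \<le> ereal (eta (l1_dist P P') (ln M) + ?c)"
  proof (cases "l1_dist P P' = 0")
    case True
    have "((\<lambda>t. ereal (eta t (ln M) + ?c)) \<longlongrightarrow> ereal (eta 0 (ln M) + ?c)) (at_right 0)"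
      by (intro tendsto_intros tendsto_eta_at_right) simp
    moreover have "eventually (\<lambda>t. Delta_min_smooth M \<epsilon> P \<le> ereal (eta t (ln M) + ?c)) (at_right 0)"
      using eventually_at_right_real[OF zero_less_one]
    proof eventually_elim
      case (elim t)
      then show ?case
        using P' True by (intro Delta_min_smooth_le) (simp_all add: smoothing_radius_def)
    qed
    ultimately show ?thesis
      unfolding True by (rule tendsto_lowerbound) simp
  next
    case False
    then have "0 < l1_dist P P'" using l1_dist_nonneg[of P P'] by linarith
    then show ?thesis using P' by (intro Delta_min_smooth_le) auto
  qed
qed

text \<open>Instead of a maximiser of the smoothed min-entropy, a \<open>P'\<close> with ratio at
  most \<open>\<tau>\<close> is taken for each \<open>\<tau>\<close> above the limiting value
  \<open>?G\<close>, and \<open>\<tau>\<close> then decreases to \<open>?G\<close>.\<close>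

lemma Delta_min_le_Delta_min_smooth: "Delta_min M \<epsilon> P \<le> Delta_min_smooth M \<epsilon> P"
  unfolding Delta_min_smooth_def
proof (rule INF_greatest)
  fix t assume t: "t \<in> {t. 0 < t \<and> t \<in> smoothing_radius M}"
  let ?G = "exp_neg (Hmin_down t P)"
  have "((\<lambda>\<tau>. ereal (eta t (ln M) + ln (1 + \<epsilon> * M * \<tau>)))
      \<longlongrightarrow> ereal (eta t (ln M) + ln (1 + \<epsilon> * M * ?G))) (at_right ?G)"
    by (intro tendsto_intros tendsto_ln_cost exp_neg_nonneg)
  moreover have "eventually (\<lambda>\<tau>. Delta_min M \<epsilon> P \<le> ereal (eta t (ln M) + ln (1 + \<epsilon> * M * \<tau>)))
      (at_right ?G)"
    using eventually_at_right_less[of ?G]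
  proof eventually_elim
    case (elim \<tau>)
    have \<tau>: "0 < \<tau>" using elim exp_neg_nonneg[of "Hmin_down t P"] by linarith
    have "ereal (- ln \<tau>) < Hmin_down t P"
      using t elim by (intro less_of_exp_neg_less Hmin_down_not_MInf) auto
    then obtain P' where P': "P' \<in> dominated_subs P" "l1_dist P P' \<le> t"
      "ereal (- ln \<tau>) < Hmin P' (marg P)"
      unfolding Hmin_down_def less_SUP_iff by auto
    have "exp_neg (Hmin P' (marg P)) \<le> exp (- (- ln \<tau>))"
      using P'(3) by (subst exp_neg_le_iff) auto
    with P' t \<tau> show ?case by (intro Delta_min_le[of t P']) auto
  qed
  ultimately show "Delta_min M \<epsilon> P \<le> ereal (eta t (ln M) + ln (1 + \<epsilon> * M * ?G))"
    by (rule tendsto_lowerbound) simp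
qed

section \<open>The form with a rate parameter\<close>

definition "rate_radius r = (INF P'\<in>{P' \<in> dominated_subs P. ereal r \<le> Hmin P' (marg P)}. l1_dist P P')"

lemma rate_radius_le:
  assumes "P' \<in> dominated_subs P" "ereal r \<le> Hmin P' (marg P)"
  shows "rate_radius r \<le> l1_dist P P'"
  unfolding rate_radius_def using assms by (intro cINF_lower bdd_belowI2[of _ 0]) simp_all

lemma rate_radius_le_1: "rate_radius r \<le> 1"
  using rate_radius_le[of "\<lambda>_ _. 0" r] P by simp

lemma rate_radius_greatest:
  assumes "\<And>P'. P' \<in> dominated_subs P \<Longrightarrow> ereal r \<le> Hmin P' (marg P) \<Longrightarrow> x \<le> l1_dist P P'"
  shows "x \<le> rate_radius r"
proof -
  have "(\<lambda>_ _. 0) \<in> {P' \<in> dominated_subs P. ereal r \<le> Hmin P' (marg P)}" using P by simp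
  then show ?thesis unfolding rate_radius_def using assms by (intro cINF_greatest) auto
qed

lemma rate_radius_nonneg: "0 \<le> rate_radius r"
  by (rule rate_radius_greatest) simp

lemma Delta_min_rate_eq:
  "Delta_min_rate M \<epsilon> P = (INF r. ereal (eta (rate_radius r) (ln M) + ln (1 + \<epsilon> * M * exp (- r))))"
  by (simp add: Delta_min_rate_def rate_radius_def)

text \<open>Min-entropy at least \<open>r\<close> caps the mass of \<open>P'\<close> at
  \<open>CARD('a) * exp (- r)\<close>, and the distance is at least the missing mass.\<close>

lemma one_minus_le_rate_radius: "1 - CARD('a) * exp (- r) \<le> rate_radius r"
proof (rule rate_radius_greatest)
  fix P' assume P': "P' \<in> dominated_subs P" "ereal r \<le> Hmin P' (marg P)"
  have g: "exp_neg (Hmin P' (marg P)) \<le> exp (- r)" using P' by (simp add: exp_neg_le_iff)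
  have mP: "0 \<le> marg P e" for e
    using P by (auto simp: prob_dist_def marg_def intro: sum_nonneg)
  have "(\<Sum>a\<in>UNIV. \<Sum>e\<in>UNIV. P' a e) \<le> (\<Sum>a\<in>(UNIV::'a set). \<Sum>e\<in>UNIV. exp (- r) * marg P e)"
    by (intro sum_mono order_trans[OF le_exp_neg_Hmin[OF P P'(1)]] mult_right_mono g mP)
  also have "\<dots> = CARD('a) * exp (- r)" by (simp add: sum_marg[OF P] flip: sum_distrib_left)
  finally have "1 - CARD('a) * exp (- r) \<le> (\<Sum>a\<in>UNIV. \<Sum>e\<in>UNIV. P a e - P' a e)"
    using P by (simp add: prob_dist_def sum_subtractf)
  also have "\<dots> \<le> l1_dist P P'" unfolding l1_dist_def by (intro sum_mono) auto
  finally show "1 - CARD('a) * exp (- r) \<le> l1_dist P P'" .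
qed

text \<open>The rate is a real number, so the cost \<open>ln M\<close> of \<open>P' = 0\<close>,
  whose min-entropy is infinite, is approached as \<open>r\<close> tends to infinity; the radius
  then tends to 1 by the sandwich above.\<close>

lemma Delta_min_rate_le_ln: "Delta_min_rate M \<epsilon> P \<le> ereal (ln M)"
proof -
  have exp0: "((\<lambda>r::real. exp (- r)) \<longlongrightarrow> 0) at_top" by real_asymp
  have "((\<lambda>r. 1 - CARD('a) * exp (- r)) \<longlongrightarrow> 1 - real CARD('a) * 0) at_top"
    by (intro tendsto_intros exp0)
  then have "(rate_radius \<longlongrightarrow> 1) at_top"
    by (intro tendsto_sandwich[of "\<lambda>r. 1 - CARD('a) * exp (- r)" rate_radius at_top "\<lambda>_. 1"])
       (simp_all add: one_minus_le_rate_radius rate_radius_le_1)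
  then have "((\<lambda>r. eta (rate_radius r) (ln M)) \<longlongrightarrow> eta 1 (ln M)) at_top"
    unfolding eta_def by (intro tendsto_intros) auto
  then have "((\<lambda>r. ereal (eta (rate_radius r) (ln M) + ln (1 + \<epsilon> * M * exp (- r))))
      \<longlongrightarrow> ereal (eta 1 (ln M) + ln (1 + \<epsilon> * M * 0))) at_top"
    by (intro tendsto_intros tendsto_ln_cost exp0) simp_all
  then have "Delta_min_rate M \<epsilon> P \<le> ereal (eta 1 (ln M) + ln (1 + \<epsilon> * M * 0))"
    by (rule tendsto_lowerbound) (auto simp: Delta_min_rate_eq intro!: INF_lower always_eventually)
  then show ?thesis by simp
qed

text \<open>The rate \<open>- ln g\<close> is the min-entropy of \<open>P'\<close> itself, and the
  radius at that rate is at most \<open>d\<close>. Costs of at least \<open>ln M\<close> are covered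
  by the previous limit.\<close>

lemma Delta_min_rate_le_Delta_min: "Delta_min_rate M \<epsilon> P \<le> Delta_min M \<epsilon> P"
  unfolding Delta_min_def
proof (rule INF_greatest)
  fix P' assume P': "P' \<in> {P' \<in> dominated_subs P. l1_dist P P' \<in> smoothing_radius M}"
  define g where "g = exp_neg (Hmin P' (marg P))"
  define d where "d = l1_dist P P'"
  have g0: "0 \<le> g" by (simp add: g_def exp_neg_nonneg)
  have "Delta_min_rate M \<epsilon> P \<le> ereal (eta d (ln M) + ln (1 + \<epsilon> * M * g))"
  proof (cases "ln M \<le> eta d (ln M)")
    case True
    with ln_cost_nonneg[OF g0] show ?thesis
      by (intro order_trans[OF Delta_min_rate_le_ln]) simp
  next
    case False
    with P' have d: "d \<le> 1" by (simp add: smoothing_radius_def d_def)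
    \<comment> \<open>A zero ratio would force \<open>P' = 0\<close>, hence \<open>d = 1\<close> and
      \<open>eta d (ln M) = ln M\<close>, which this case excludes.\<close>
    have "g \<noteq> 0"
    proof
      assume "g = 0"
      with P' have "P' a e \<le> 0" for a e
        using le_exp_neg_Hmin[OF P, of P' a e] by (simp add: g_def)
      moreover have "0 \<le> P' a e" for a e using P' by (simp add: dominated_subs_def sub_dist_def)
      ultimately have "P' = (\<lambda>_ _. 0)" by (intro ext antisym)
      with False P show False by (simp add: d_def)
    qed
    with g0 have g: "exp (- (- ln g)) = g" by simp
    have "exp_neg (Hmin P' (marg P)) \<le> exp (- (- ln g))" unfolding g by (simp add: g_def)
    then have "ereal (- ln g) \<le> Hmin P' (marg P)" by (subst (asm) exp_neg_le_iff) simp_all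
    then have "rate_radius (- ln g) \<le> d"
      using P' by (simp add: d_def rate_radius_le)
    then have "eta (rate_radius (- ln g)) (ln M) \<le> eta d (ln M)"
      using False d M rate_radius_nonneg by (intro eta_mono_below_ln) auto
    moreover have "Delta_min_rate M \<epsilon> P
        \<le> ereal (eta (rate_radius (- ln g)) (ln M) + ln (1 + \<epsilon> * M * exp (- (- ln g))))"
      unfolding Delta_min_rate_eq by (intro INF_lower) simp
    ultimately show ?thesis unfolding g by (elim order_trans) simp
  qed
  then show "Delta_min_rate M \<epsilon> P
      \<le> ereal (eta (l1_dist P P') (ln M) + ln (1 + \<epsilon> * M * exp_neg (Hmin P' (marg P))))"
    by (simp add: g_def d_def)
qed

text \<open>For \<open>t\<close> strictly between the radius and 1 some admissible \<open>P'\<close>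
  lies within distance \<open>t\<close>; letting \<open>t\<close> decrease to the radius gives the
  claim. A radius of 1 leaves no such \<open>t\<close>, and there the cost is at least
  \<open>ln M\<close>.\<close>

lemma Delta_min_le_Delta_min_rate: "Delta_min M \<epsilon> P \<le> Delta_min_rate M \<epsilon> P"
  unfolding Delta_min_rate_eq
proof (rule INF_greatest)
  fix r
  let ?c = "ln (1 + \<epsilon> * M * exp (- r))"
  show "Delta_min M \<epsilon> P \<le> ereal (eta (rate_radius r) (ln M) + ?c)"
  proof (cases "rate_radius r = 1")
    case True
    then show ?thesis using ln_cost_nonneg[of "exp (- r)"]
      by (intro order_trans[OF Delta_min_le_ln]) simp
  next
    case False
    with rate_radius_le_1[of r] have lt: "rate_radius r < 1" by linarith
    have "((\<lambda>t. ereal (eta t (ln M) + ?c)) \<longlongrightarrow> ereal (eta (rate_radius r) (ln M) + ?c))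
        (at_right (rate_radius r))"
      by (intro tendsto_intros tendsto_eta_at_right rate_radius_nonneg)
    moreover have "eventually (\<lambda>t. Delta_min M \<epsilon> P \<le> ereal (eta t (ln M) + ?c))
        (at_right (rate_radius r))"
      using eventually_at_right_real[OF lt]
    proof eventually_elim
      case (elim t)
      then have "\<not> t \<le> rate_radius r" by simp
      then obtain P' where P': "P' \<in> dominated_subs P" "ereal r \<le> Hmin P' (marg P)"
        "l1_dist P P' \<le> t"
        using rate_radius_greatest[of r t] by force
      then show ?case
        using elim by (intro Delta_min_le[of t P'])
          (auto simp: smoothing_radius_def exp_neg_le_iff)
    qed
    ultimately show ?thesis by (rule tendsto_lowerbound) simp
  qed
qed

end

section \<open>The bound for a given smoothing, and the conclusion\<close>

lemma expectation_I'_le: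
  fixes P :: "('k::{field,finite})^'n \<Rightarrow> 'e::finite \<Rightarrow> real"
    and f :: "'x \<Rightarrow> 'k^'n \<Rightarrow> 'k^'m"
  assumes P: "prob_dist P" and lin: "linear_hash X f" and uni: "almost_dual_universal2 \<epsilon> X f"
    and M: "M = real CARD('k) ^ CARD('m)"
    and P': "P' \<in> dominated_subs P" "l1_dist P P' \<in> smoothing_radius M"
  shows "measure_pmf.expectation X (\<lambda>x. I' (f x) P)
    \<le> eta (l1_dist P P') (ln M) + ln (1 + \<epsilon> * M * exp_neg (Hmin P' (marg P)))
       + measure_pmf.expectation X (\<lambda>x. ln (M / card (range (f x))))"
proof -
  \<comment> \<open>Domination of marginals does not give \<open>P' \<le> P\<close> pointwise, as
    the bound for minorants requires. The minimum does, keeps the ratio bound, and loses at most the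
    mass \<open>l1_dist P P'\<close>.\<close>
  define P'' where "P'' a e = min (P a e) (P' a e)" for a e
  have nn: "0 \<le> P' a e" "0 \<le> P a e" for a e
    using P P' by (auto simp: dominated_subs_def sub_dist_def prob_dist_def)
  have P'': "0 \<le> P'' a e" "P'' a e \<le> P a e" for a e using nn by (auto simp: P''_def)
  have g: "P'' a e \<le> exp_neg (Hmin P' (marg P)) * marg P e" for a e
    using le_exp_neg_Hmin[OF P P'(1), of a e] by (simp add: P''_def)
  have M1: "1 \<le> M" unfolding M by (intro one_le_power) (use card_field_ge_2[where 'k = 'k] in simp)
  define d where "d = 1 - (\<Sum>e\<in>UNIV. marg P'' e)"
  have d: "d = (\<Sum>a\<in>UNIV. \<Sum>e\<in>UNIV. P a e - P'' a e)"
  proof -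
    have "(\<Sum>e\<in>UNIV. marg P'' e) = (\<Sum>a\<in>UNIV. \<Sum>e\<in>UNIV. P'' a e)"
      unfolding marg_def by (rule sum.swap)
    then show ?thesis using P by (simp add: d_def prob_dist_def sum_subtractf)
  qed
  have "0 \<le> d" unfolding d using P'' by (intro sum_nonneg) simp
  moreover have "d \<le> 1" unfolding d_def marg_def using P'' by (simp add: sum_nonneg)
  moreover have "d \<le> l1_dist P P'"
    unfolding d l1_dist_def by (intro sum_mono) (auto simp: P''_def)
  ultimately have "d * ln M \<le> eta (l1_dist P P') (ln M)"
    using P' M1 by (intro mult_le_eta_radius) auto
  with expectation_I'_le_minor[OF P lin uni M P'' exp_neg_nonneg g]
  show ?thesis unfolding d_def by linarith
qed

theorem theorem30:
  fixes P :: "('k::{field,finite})^'n \<Rightarrow> 'e::finite \<Rightarrow> real"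
    and X :: "'x pmf"
    and f :: "'x \<Rightarrow> 'k^'n \<Rightarrow> 'k^'m"
    and \<epsilon> M :: real
  assumes "CARD('m) \<le> CARD('n)"
    and "M = real CARD('k) ^ CARD('m)"
    and "prob_dist P"
    and "linear_hash X f"
    and "almost_dual_universal2 \<epsilon> X f"
  shows "((\<forall>x\<in>set_pmf X. surj (f x)) \<longrightarrow>
            ereal (measure_pmf.expectation X (\<lambda>x. I' (f x) P)) \<le> Delta_min M \<epsilon> P)
       \<and> ereal (measure_pmf.expectation X (\<lambda>x. I' (f x) P))
            \<le> Delta_min M \<epsilon> P
              + ereal (measure_pmf.expectation X (\<lambda>x. ln (M / real (card (range (f x))))))
       \<and> Delta_min M \<epsilon> P = Delta_min_smooth M \<epsilon> P
       \<and> Delta_min_smooth M \<epsilon> P = Delta_min_rate M \<epsilon> P"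
proof -
  note M = assms(2) and P = assms(3) and lin = assms(4) and uni = assms(5)
  let ?I = "measure_pmf.expectation X (\<lambda>x. I' (f x) P)"
  let ?R = "measure_pmf.expectation X (\<lambda>x. ln (M / real (card (range (f x)))))"
  have M1: "1 \<le> M" unfolding M by (intro one_le_power) (use card_field_ge_2[where 'k = 'k] in simp)
  note ctxt = P M1 universal2_nonneg[OF uni]
  \<comment> \<open>The correction \<open>?R\<close> does not depend on \<open>P'\<close>, so it is
    moved to the left before passing to the infimum.\<close>
  have "ereal (?I - ?R) \<le> Delta_min M \<epsilon> P"
    unfolding Delta_min_def
    by (intro INF_greatest) (use expectation_I'_le[OF P lin uni M] in \<open>force simp: algebra_simps\<close>)
  then have bound: "ereal ?I \<le> Delta_min M \<epsilon> P + ereal ?R"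
    by (cases "Delta_min M \<epsilon> P") auto
  \<comment> \<open>A surjective hash has a range of exactly \<open>M\<close> elements, so the
    logarithm is that of 1.\<close>
  have "?R = 0" if "\<forall>x\<in>set_pmf X. surj (f x)"
  proof -
    have "?R = measure_pmf.expectation X (\<lambda>x. 0)"
      using that M M1 by (intro integral_cong_AE AE_pmfI) auto
    then show ?thesis by simp
  qed
  with bound have "(\<forall>x\<in>set_pmf X. surj (f x)) \<longrightarrow> ereal ?I \<le> Delta_min M \<epsilon> P" by auto
  moreover have "Delta_min M \<epsilon> P = Delta_min_smooth M \<epsilon> P"
    using Delta_min_le_Delta_min_smooth[OF ctxt] Delta_min_smooth_le_Delta_min[OF ctxt]
    by (rule antisym)
  moreover have "Delta_min M \<epsilon> P = Delta_min_rate M \<epsilon> P"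
    using Delta_min_le_Delta_min_rate[OF ctxt] Delta_min_rate_le_Delta_min[OF ctxt]
    by (rule antisym)
  ultimately show ?thesis using bound by simp
qed

end
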